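(* Let $\{e_1,e_2,e_3\}$ be the basis of $\mathfrak{sl}_2(\mathbb{R})$ with $[e_1,e_2]=-2e_3$, $[e_1,e_3]=2e_2$, $[e_2,e_3]=2e_1$, let $e_4$ span the factor $\mathbb{R}$ in $\mathfrak{sl}_2(\mathbb{R})\oplus\mathbb{R}$, and let $\{e^1,e^2,e^3,e^4\}$ be the dual basis. Up to automorphisms of the Lie algebra, every lcs structure on $\mathfrak{sl}_2(\mathbb{R})\oplus\mathbb{R}$ is equivalent to one of $$(\Omega_r,\vartheta)=\bigl(\pm r(e^{14}-2e^{23}),\,e^4\bigr)\qquad\text{or}\qquad(\Omega_r,\vartheta)=\bigl(r(-2e^{13}+e^{24}),\,e^4\bigr)$$ for a constant $r>0$.
   Context: $e^{ij}:=e^i\wedge e^j$; $d$ is the Chevalley–Eilenberg differential, so $de^1=-2e^{23}$, $de^2=-2e^{13}$, $de^3=2e^{12}$, $de^4=0$. An lcs structure on a $4$-dimensional real Lie algebra $\mathfrak{g}$ is a pair $(\Omega,\vartheta)\in\Lambda^2\mathfrak{g}^*\times\mathfrak{g}^*$ with $\Omega^2\neq0$, $d\vartheta=0$, $d\Omega=\vartheta\wedge\Omega$. Two lcs structures are equivalent if a Lie algebra automorphism of $\mathfrak{g}$ pulls back one pair to the other. *)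

theory Defs
  imports "HOL-Analysis.Analysis"
begin

section \<open>Real Lie algebras and forms of low degree\<close>

text \<open>
  A Lie algebra is a real vector space type together with a bracket.  Elements of
  the exterior powers of its dual are alternating multilinear functions.
\<close>

definition lie_algebra :: "('a::real_vector \<Rightarrow> 'a \<Rightarrow> 'a) \<Rightarrow> bool" where
  "lie_algebra br \<longleftrightarrow> bilinear br \<and> (\<forall>x. br x x = 0) \<and>
     (\<forall>x y z. br x (br y z) + br y (br z x) + br z (br x y) = 0)"

definition lie_automorphism ::
    "('a::real_vector \<Rightarrow> 'a \<Rightarrow> 'a) \<Rightarrow> ('a \<Rightarrow> 'a) \<Rightarrow> bool" where
  "lie_automorphism br \<phi> \<longleftrightarrow>
     linear \<phi> \<and> bij \<phi> \<and> (\<forall>x y. \<phi> (br x y) = br (\<phi> x) (\<phi> y))"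

definition two_form :: "('a::real_vector \<Rightarrow> 'a \<Rightarrow> real) \<Rightarrow> bool" where
  "two_form \<omega> \<longleftrightarrow> bilinear \<omega> \<and> (\<forall>x. \<omega> x x = 0)"

text \<open>
  The wedge product is normalised by
  \<open>(\<alpha> \<and> \<beta>)(x, y) = \<alpha>(x) \<beta>(y) - \<alpha>(y) \<beta>(x)\<close>, that is, by summing over
  shuffles without a factorial.
\<close>

definition wedge11 :: "('a \<Rightarrow> real) \<Rightarrow> ('a \<Rightarrow> real) \<Rightarrow> 'a \<Rightarrow> 'a \<Rightarrow> real" where
  "wedge11 \<alpha> \<beta> x y = \<alpha> x * \<beta> y - \<alpha> y * \<beta> x"

definition wedge12 ::
    "('a \<Rightarrow> real) \<Rightarrow> ('a \<Rightarrow> 'a \<Rightarrow> real) \<Rightarrow> 'a \<Rightarrow> 'a \<Rightarrow> 'a \<Rightarrow> real" where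
  "wedge12 \<alpha> \<omega> x y z = \<alpha> x * \<omega> y z - \<alpha> y * \<omega> x z + \<alpha> z * \<omega> x y"

definition wedge22 ::
    "('a \<Rightarrow> 'a \<Rightarrow> real) \<Rightarrow> ('a \<Rightarrow> 'a \<Rightarrow> real) \<Rightarrow> 'a \<Rightarrow> 'a \<Rightarrow> 'a \<Rightarrow> 'a \<Rightarrow> real" where
  "wedge22 \<omega> \<eta> x y z w =
     \<omega> x y * \<eta> z w - \<omega> x z * \<eta> y w + \<omega> x w * \<eta> y z +
     \<omega> y z * \<eta> x w - \<omega> y w * \<eta> x z + \<omega> z w * \<eta> x y"

text \<open>The Chevalley--Eilenberg differential (trivial coefficients) in degrees 1 and 2.\<close>

definition ce_d1 ::
    "('a \<Rightarrow> 'a \<Rightarrow> 'a) \<Rightarrow> ('a \<Rightarrow> real) \<Rightarrow> 'a \<Rightarrow> 'a \<Rightarrow> real" where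
  "ce_d1 br \<alpha> x y = - \<alpha> (br x y)"

definition ce_d2 ::
    "('a \<Rightarrow> 'a \<Rightarrow> 'a) \<Rightarrow> ('a \<Rightarrow> 'a \<Rightarrow> real) \<Rightarrow> 'a \<Rightarrow> 'a \<Rightarrow> 'a \<Rightarrow> real" where
  "ce_d2 br \<omega> x y z = - \<omega> (br x y) z + \<omega> (br x z) y - \<omega> (br y z) x"

section \<open>Locally conformally symplectic structures\<close>

type_synonym 'a form_pair = "('a \<Rightarrow> 'a \<Rightarrow> real) \<times> ('a \<Rightarrow> real)"

text \<open>
  The nondegeneracy condition \<open>\<Omega> \<and> \<Omega> \<noteq> 0\<close> is the one
  appropriate to dimension 4.
\<close>

definition lcs_structure ::
    "('a::real_vector \<Rightarrow> 'a \<Rightarrow> 'a) \<Rightarrow> 'a form_pair \<Rightarrow> bool" where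
  "lcs_structure br = (\<lambda>(\<Omega>, \<theta>). two_form \<Omega> \<and> linear \<theta> \<and>
     wedge22 \<Omega> \<Omega> \<noteq> (\<lambda>_ _ _ _. 0) \<and>
     ce_d1 br \<theta> = (\<lambda>_ _. 0) \<and>
     ce_d2 br \<Omega> = wedge12 \<theta> \<Omega>)"

definition pullback_pair :: "('a \<Rightarrow> 'a) \<Rightarrow> 'a form_pair \<Rightarrow> 'a form_pair" where
  "pullback_pair \<phi> = (\<lambda>(\<Omega>, \<theta>). (\<lambda>x y. \<Omega> (\<phi> x) (\<phi> y), \<lambda>x. \<theta> (\<phi> x)))"

definition lcs_equivalent ::
    "('a::real_vector \<Rightarrow> 'a \<Rightarrow> 'a) \<Rightarrow> 'a form_pair \<Rightarrow> 'a form_pair \<Rightarrow> bool" where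
  "lcs_equivalent br P Q \<longleftrightarrow> lcs_structure br P \<and> lcs_structure br Q \<and>
     (\<exists>\<phi>. lie_automorphism br \<phi> \<and> pullback_pair \<phi> Q = P)"

section \<open>Bases and dual bases\<close>

definition is_basis :: "'a::real_vector list \<Rightarrow> bool" where
  "is_basis bs \<longleftrightarrow> distinct bs \<and> independent (set bs) \<and> span (set bs) = UNIV"

definition is_dual_basis ::
    "'a::real_vector list \<Rightarrow> ('a \<Rightarrow> real) list \<Rightarrow> bool" where
  "is_dual_basis bs fs \<longleftrightarrow> length fs = length bs \<and> (\<forall>i<length bs.
     linear (fs ! i) \<and> (\<forall>j<length bs. (fs ! i) (bs ! j) = (if i = j then 1 else 0)))"

section \<open>The Lie algebra \<open>sl\<^sub>2(\<real>) \<oplus> \<real>\<close>\<close>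

typedef sl2 = "{A :: real^2^2. trace A = 0}"
  morphisms mat_of_sl2 sl2_of_mat
  by (rule exI[of _ 0]) (simp add: trace_def)

setup_lifting type_definition_sl2

lemma trace_scaleR: "trace (c *\<^sub>R A) = c * trace A" for A :: "real^'n^'n"
  by (simp add: trace_def sum_distrib_left)

instantiation sl2 :: real_vector
begin

lift_definition zero_sl2 :: sl2 is 0
  by (simp add: trace_def)
lift_definition plus_sl2 :: "sl2 \<Rightarrow> sl2 \<Rightarrow> sl2" is "(+)"
  by (simp add: trace_add)
lift_definition minus_sl2 :: "sl2 \<Rightarrow> sl2 \<Rightarrow> sl2" is "(-)"
  by (simp add: trace_sub)
lift_definition uminus_sl2 :: "sl2 \<Rightarrow> sl2" is uminus
  by (simp add: trace_def sum_negf)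
lift_definition scaleR_sl2 :: "real \<Rightarrow> sl2 \<Rightarrow> sl2" is scaleR
  by (simp add: trace_scaleR)

instance
proof
  fix a b :: real and x y z :: sl2
  note eqs = mat_of_sl2_inject[symmetric] zero_sl2.rep_eq plus_sl2.rep_eq minus_sl2.rep_eq
    uminus_sl2.rep_eq scaleR_sl2.rep_eq
  show "x + y + z = x + (y + z)" "x + y = y + x" "0 + x = x" "- x + x = 0" "x - y = x + - y"
    by (simp_all add: eqs add_ac)
  show "a *\<^sub>R (x + y) = a *\<^sub>R x + a *\<^sub>R y" "(a + b) *\<^sub>R x = a *\<^sub>R x + b *\<^sub>R x"
    "a *\<^sub>R b *\<^sub>R x = (a * b) *\<^sub>R x" "1 *\<^sub>R x = x"
    by (simp_all add: eqs scaleR_add_left scaleR_add_right)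
qed

end

lift_definition sl2_bracket :: "sl2 \<Rightarrow> sl2 \<Rightarrow> sl2" is "\<lambda>A B. A ** B - B ** A"
  by (simp only: mem_Collect_eq trace_sub, subst trace_mul_sym) simp

definition sl2R_bracket :: "sl2 \<times> real \<Rightarrow> sl2 \<times> real \<Rightarrow> sl2 \<times> real" where
  "sl2R_bracket = (\<lambda>(A, s) (B, t). (sl2_bracket A B, 0))"

lemma lie_algebra_sl2: "lie_algebra sl2_bracket"
proof -
  have "sl2_bracket (A + B) C = sl2_bracket A C + sl2_bracket B C"
    "sl2_bracket C (A + B) = sl2_bracket C A + sl2_bracket C B"
    "sl2_bracket (c *\<^sub>R A) B = c *\<^sub>R sl2_bracket A B"
    "sl2_bracket A (c *\<^sub>R B) = c *\<^sub>R sl2_bracket A B" for A B C c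
    by (transfer; simp add: vec_eq_iff matrix_matrix_mult_def sum_2 forall_2 algebra_simps)+
  moreover have "sl2_bracket A A = 0" for A
    by transfer simp
  moreover have "sl2_bracket A (sl2_bracket B C) + sl2_bracket B (sl2_bracket C A) +
      sl2_bracket C (sl2_bracket A B) = 0" for A B C
    by transfer (simp add: vec_eq_iff matrix_matrix_mult_def sum_2 forall_2 algebra_simps)
  ultimately show ?thesis
    by (simp add: lie_algebra_def bilinear_def linear_iff)
qed

lemma lie_algebra_sl2R: "lie_algebra sl2R_bracket"
  using lie_algebra_sl2
  by (simp add: lie_algebra_def bilinear_def linear_iff sl2R_bracket_def prod_eq_iff
      case_prod_beta)

text \<open>A basis of \<open>sl\<^sub>2(\<real>)\<close> with the structure constants used below exists.\<close>

lemma sl2_basis_exists: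
  "\<exists>e1 e2 e3. is_basis [e1, e2, e3] \<and> sl2_bracket e1 e2 = (-2) *\<^sub>R e3 \<and>
     sl2_bracket e1 e3 = 2 *\<^sub>R e2 \<and> sl2_bracket e2 e3 = 2 *\<^sub>R e1"
proof -
  define J :: "real^2^2" where "J = vector [vector [0, 1], vector [-1, 0]]"
  define H :: "real^2^2" where "H = vector [vector [1, 0], vector [0, -1]]"
  define S :: "real^2^2" where "S = vector [vector [0, 1], vector [1, 0]]"
  note defs = J_def H_def S_def
  define e1 e2 e3 where "e1 = sl2_of_mat J" and "e2 = sl2_of_mat H" and "e3 = sl2_of_mat S"
  have rep: "mat_of_sl2 e1 = J" "mat_of_sl2 e2 = H" "mat_of_sl2 e3 = S"
    unfolding e1_def e2_def e3_def
    by (subst sl2_of_mat_inverse; simp add: trace_def sum_2 defs)+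
  have comb: "mat_of_sl2 (a *\<^sub>R e1 + b *\<^sub>R e2 + c *\<^sub>R e3) = a *\<^sub>R J + b *\<^sub>R H + c *\<^sub>R S" for a b c
    by (simp add: plus_sl2.rep_eq scaleR_sl2.rep_eq rep)
  have br: "sl2_bracket e1 e2 = (-2) *\<^sub>R e3" "sl2_bracket e1 e3 = 2 *\<^sub>R e2"
      "sl2_bracket e2 e3 = 2 *\<^sub>R e1"
    by (simp_all add: mat_of_sl2_inject[symmetric] sl2_bracket.rep_eq scaleR_sl2.rep_eq
        uminus_sl2.rep_eq rep vec_eq_iff matrix_matrix_mult_def sum_2 forall_2 defs)
  have zero: "a = 0 \<and> b = 0 \<and> c = 0" if "a *\<^sub>R e1 + b *\<^sub>R e2 + c *\<^sub>R e3 = 0" for a b c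
  proof -
    have "a *\<^sub>R J + b *\<^sub>R H + c *\<^sub>R S = 0"
      using arg_cong[OF that, of mat_of_sl2] by (simp only: comb zero_sl2.rep_eq)
    then show ?thesis
      by (simp add: vec_eq_iff forall_2 defs)
  qed
  have dist: "distinct [e1, e2, e3]"
    using zero[of 1 "-1" 0] zero[of 1 0 "-1"] zero[of 0 1 "-1"] by auto
  have indep: "independent {e1, e2, e3}"
  proof (rule independent_if_scalars_zero)
    fix f x assume *: "(\<Sum>x\<in>{e1, e2, e3}. f x *\<^sub>R x) = 0" "x \<in> {e1, e2, e3}"
    then show "f x = 0"
      using dist zero[of "f e1" "f e2" "f e3"] by (auto simp: add.assoc)
  qed simp
  have "x \<in> span {e1, e2, e3}" for x
  proof -
    let ?M = "mat_of_sl2 x"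
    have tr: "?M $ 1 $ 1 + ?M $ 2 $ 2 = 0"
      using mat_of_sl2[of x] by (simp add: trace_def sum_2)
    have "x = ((?M$1$2 - ?M$2$1) / 2) *\<^sub>R e1 + (?M$1$1) *\<^sub>R e2 + ((?M$1$2 + ?M$2$1) / 2) *\<^sub>R e3"
      unfolding mat_of_sl2_inject[symmetric] comb
      using tr by (simp add: vec_eq_iff forall_2 defs field_simps)
    then show ?thesis
      by (metis insertCI span_add span_base span_scale)
  qed
  then show ?thesis
    using br dist indep unfolding is_basis_def by (intro exI[of _ e1] exI[of _ e2] exI[of _ e3]) auto
qed

text \<open>
  The structure equations of \<open>sl\<^sub>2(\<real>) \<oplus> \<real>\<close> fix the sign conventions of
  \<^const>\<open>ce_d1\<close> and \<^const>\<open>wedge11\<close>.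
\<close>

lemma ce_d1_dual_basis:
  assumes basis: "is_basis [e1, e2, e3]"
    and br: "sl2_bracket e1 e2 = (-2) *\<^sub>R e3" "sl2_bracket e1 e3 = 2 *\<^sub>R e2"
      "sl2_bracket e2 e3 = 2 *\<^sub>R e1"
    and dual: "is_dual_basis [(e1, 0), (e2, 0), (e3, 0), (0, e4)] [f1, f2, f3, f4]"
  shows "ce_d1 sl2R_bracket f1 x y = - 2 * wedge11 f2 f3 x y"
    and "ce_d1 sl2R_bracket f2 x y = - 2 * wedge11 f1 f3 x y"
    and "ce_d1 sl2R_bracket f3 x y = 2 * wedge11 f1 f2 x y"
    and "ce_d1 sl2R_bracket f4 x y = 0"
proof -
  have lin: "linear f1" "linear f2" "linear f3" "linear f4"
    and val: "f1 (e1, 0) = 1" "f1 (e2, 0) = 0" "f1 (e3, 0) = 0" "f1 (0, e4) = 0"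
      "f2 (e1, 0) = 0" "f2 (e2, 0) = 1" "f2 (e3, 0) = 0" "f2 (0, e4) = 0"
      "f3 (e1, 0) = 0" "f3 (e2, 0) = 0" "f3 (e3, 0) = 1" "f3 (0, e4) = 0"
      "f4 (e1, 0) = 0" "f4 (e2, 0) = 0" "f4 (e3, 0) = 0" "f4 (0, e4) = 1"
    using dual by (simp_all add: is_dual_basis_def All_less_Suc numeral_eq_Suc)
  have "e4 \<noteq> 0"
    using val(16) linear_0[OF lin(4)] by (auto simp: zero_prod_def)
  define v where "v a b c s = (a *\<^sub>R e1 + b *\<^sub>R e2 + c *\<^sub>R e3, s * e4)" for a b c s
  have v: "v a b c s = a *\<^sub>R (e1, 0) + b *\<^sub>R (e2, 0) + c *\<^sub>R (e3, 0) + s *\<^sub>R (0, e4)" for a b c s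
    by (simp add: v_def)
  have f: "f1 (v a b c s) = a" "f2 (v a b c s) = b" "f3 (v a b c s) = c" "f4 (v a b c s) = s"
    for a b c s
    unfolding v using lin by (simp_all only: linear_add linear_scale val) simp_all
  have ex: "\<exists>a b c s. z = v a b c s" for z
  proof -
    obtain A t where z: "z = (A, t)" by (cases z)
    have "A \<in> span {e1, e2, e3}" using basis by (simp add: is_basis_def)
    then obtain a b c where "A - a *\<^sub>R e1 - b *\<^sub>R e2 - c *\<^sub>R e3 = 0"
      by (auto simp: span_insert)
    then have "A = a *\<^sub>R e1 + b *\<^sub>R e2 + c *\<^sub>R e3"
      by (simp add: algebra_simps)
    then have "z = v a b c (t / e4)"
      using \<open>e4 \<noteq> 0\<close> by (simp add: z v_def)
    then show ?thesis by blast
  qed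
  note la = lie_algebra_sl2[unfolded lie_algebra_def bilinear_def linear_iff]
  have self: "sl2_bracket A A = 0" for A using la by blast
  have distl: "sl2_bracket (A + B) C = sl2_bracket A C + sl2_bracket B C"
    and distr: "sl2_bracket C (A + B) = sl2_bracket C A + sl2_bracket C B"
    and scl: "sl2_bracket (k *\<^sub>R A) B = k *\<^sub>R sl2_bracket A B"
    and scr: "sl2_bracket A (k *\<^sub>R B) = k *\<^sub>R sl2_bracket A B" for A B C k
    using la by blast+
  have anti: "sl2_bracket B A = - sl2_bracket A B" for A B
    using self[of "A + B", unfolded distl, unfolded distr]
    by (simp add: self eq_neg_iff_add_eq_0 add.commute)
  have br': "sl2_bracket e2 e1 = 2 *\<^sub>R e3" "sl2_bracket e3 e1 = (-2) *\<^sub>R e2"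
      "sl2_bracket e3 e2 = (-2) *\<^sub>R e1"
    by (simp_all add: anti[where B = e2 and A = e1] anti[where B = e3 and A = e1]
        anti[where B = e3 and A = e2] br)
  have brv: "sl2R_bracket (v a b c s) (v a' b' c' s') =
      v (2 * (b * c' - c * b')) (2 * (a * c' - c * a')) (- 2 * (a * b' - b * a')) 0"
    for a b c s a' b' c' s'
    unfolding v_def sl2R_bracket_def
    by (simp only: prod.case distl distr scl scr self br br' scaleR_scaleR)
      (simp add: scaleR_left_distrib scaleR_left_diff_distrib algebra_simps)
  obtain a b c s where x: "x = v a b c s" using ex by blast
  obtain a' b' c' s' where y: "y = v a' b' c' s'" using ex by blast
  show "ce_d1 sl2R_bracket f1 x y = - 2 * wedge11 f2 f3 x y"
    "ce_d1 sl2R_bracket f2 x y = - 2 * wedge11 f1 f3 x y"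
    "ce_d1 sl2R_bracket f3 x y = 2 * wedge11 f1 f2 x y"
    "ce_d1 sl2R_bracket f4 x y = 0"
    by (simp_all add: ce_d1_def wedge11_def x y brv f algebra_simps)
qed

end

theory Submission
  imports Defs
begin

text \<open>
  With \<open>\<alpha> = \<Omega>(\<cdot>, e\<^sub>4)\<close> and \<open>\<theta> = t e\<^sup>4\<close>, contracting \<open>d\<Omega> = \<theta> \<and> \<Omega>\<close> with the
  central vector \<open>e\<^sub>4\<close> gives \<open>t \<Omega> = d\<alpha> + t \<alpha> \<and> e\<^sup>4\<close>. Nondegeneracy says that \<open>t \<noteq> 0\<close>
  and that the restriction of \<open>\<alpha>\<close> to \<open>sl\<^sub>2(\<real>)\<close> is not lightlike for the Killing form. Explicit elements
  of \<open>SO(1, 2)\<close>, acting by automorphisms, carry \<open>\<alpha> / t\<close> to \<open>\<plusminus>r e\<^sup>1\<close> if it is timelike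
  and to \<open>r e\<^sup>2\<close> if it is spacelike.
\<close>

section \<open>Transport of lcs structures along automorphisms\<close>

lemma lie_automorphism_inv:
  assumes "lie_automorphism br \<phi>"
  shows "lie_automorphism br (inv \<phi>)"
proof -
  have lin: "linear \<phi>" and bij: "bij \<phi>" and br: "\<And>x y. \<phi> (br x y) = br (\<phi> x) (\<phi> y)"
    using assms by (auto simp: lie_automorphism_def)
  have surj: "\<phi> (inv \<phi> x) = x" for x
    using bij by (simp add: bij_is_surj surj_f_inv_f)
  have eqI: "x = y" if "\<phi> x = \<phi> y" for x y
    using that bij by (meson bij_is_inj injD)
  have "linear (inv \<phi>)"
    by (rule linearI; rule eqI) (simp_all add: linear_add[OF lin] linear_scale[OF lin] surj)
  moreover have "inv \<phi> (br x y) = br (inv \<phi> x) (inv \<phi> y)" for x y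
    by (rule eqI) (simp add: br surj)
  ultimately show ?thesis
    using bij by (simp add: lie_automorphism_def bij_imp_bij_inv)
qed

lemma lcs_structure_pullback:
  assumes P: "lcs_structure br P" and \<phi>: "lie_automorphism br \<phi>"
  shows "lcs_structure br (pullback_pair \<phi> P)"
proof -
  obtain \<Omega> \<theta> where P_eq: "P = (\<Omega>, \<theta>)" by (cases P)
  have lin: "linear \<phi>" and surj: "surj \<phi>" and br: "\<And>x y. \<phi> (br x y) = br (\<phi> x) (\<phi> y)"
    using \<phi> by (auto simp: lie_automorphism_def bij_is_surj)
  have \<Omega>: "two_form \<Omega>" and \<theta>: "linear \<theta>" and nondeg: "wedge22 \<Omega> \<Omega> \<noteq> (\<lambda>_ _ _ _. 0)"
    and closed: "\<And>x y. ce_d1 br \<theta> x y = 0" and d\<Omega>: "\<And>x y z. ce_d2 br \<Omega> x y z = wedge12 \<theta> \<Omega> x y z"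
    using P by (auto simp: P_eq lcs_structure_def)
  have "two_form (\<lambda>x y. \<Omega> (\<phi> x) (\<phi> y))"
    using \<Omega> lin by (simp add: two_form_def bilinear_def linear_iff)
  moreover have "linear (\<lambda>x. \<theta> (\<phi> x))"
    using \<theta> lin by (simp add: linear_iff)
  moreover obtain x y z w where "wedge22 \<Omega> \<Omega> x y z w \<noteq> 0"
    using nondeg by (metis ext)
  \<comment> \<open>Nondegeneracy survives because \<open>\<phi>\<close> is onto: the pullback is
    evaluated at preimages of vectors on which \<open>wedge22 \<Omega> \<Omega>\<close> is
    nonzero.\<close>
  then have "wedge22 (\<lambda>x y. \<Omega> (\<phi> x) (\<phi> y)) (\<lambda>x y. \<Omega> (\<phi> x) (\<phi> y))
      (inv \<phi> x) (inv \<phi> y) (inv \<phi> z) (inv \<phi> w) \<noteq> 0"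
    by (simp add: wedge22_def surj_f_inv_f[OF surj])
  then have "wedge22 (\<lambda>x y. \<Omega> (\<phi> x) (\<phi> y)) (\<lambda>x y. \<Omega> (\<phi> x) (\<phi> y)) \<noteq> (\<lambda>_ _ _ _. 0)"
    by metis
  moreover have "ce_d1 br (\<lambda>x. \<theta> (\<phi> x)) x y = 0" for x y
    using closed[of "\<phi> x" "\<phi> y"] by (simp add: ce_d1_def br)
  moreover have "ce_d2 br (\<lambda>x y. \<Omega> (\<phi> x) (\<phi> y)) x y z =
      wedge12 (\<lambda>x. \<theta> (\<phi> x)) (\<lambda>x y. \<Omega> (\<phi> x) (\<phi> y)) x y z" for x y z
    using d\<Omega>[of "\<phi> x" "\<phi> y" "\<phi> z"] by (simp add: ce_d2_def wedge12_def br)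
  ultimately show ?thesis
    by (simp add: P_eq pullback_pair_def lcs_structure_def fun_eq_iff)
qed

text \<open>Since \<open>Q\<close> is the pullback of \<open>P\<close> along
  \<open>inv \<phi>\<close>, it inherits the lcs conditions. The normal forms thus become lcs
  structures without a separate computation.\<close>

lemma lcs_equivalent_pullbackI:
  assumes P: "lcs_structure br P" and \<phi>: "lie_automorphism br \<phi>" and Q: "pullback_pair \<phi> Q = P"
  shows "lcs_equivalent br P Q"
proof -
  have "surj \<phi>"
    using \<phi> by (simp add: lie_automorphism_def bij_is_surj)
  then have "pullback_pair (inv \<phi>) P = Q"
    by (simp add: Q[symmetric] pullback_pair_def case_prod_beta surj_f_inv_f)
  then have "lcs_structure br Q"
    using lcs_structure_pullback[OF P lie_automorphism_inv[OF \<phi>]] by simp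
  then show ?thesis
    using assms by (auto simp: lcs_equivalent_def)
qed

section \<open>Coordinates in a coframe adapted to the structure equations\<close>

text \<open>Only coordinates and structure constants are kept, so that identities between vectors or
  forms become polynomial identities in \<open>F1 x\<close>, ..., \<open>F4 x\<close>. By
  \<open>F_br\<close> the bracket is twice the Lorentzian cross product in the first three
  coordinates, for the form with signature (+,-,-). This is why SO(1,2) acts by
  automorphisms.\<close>

locale sl2R_coframe =
  fixes br :: "'a::real_vector \<Rightarrow> 'a \<Rightarrow> 'a" and E1 E2 E3 E4 :: 'a and F1 F2 F3 F4 :: "'a \<Rightarrow> real"
  assumes linear_F: "linear F1" "linear F2" "linear F3" "linear F4"
    and F_E: "F1 E1 = 1" "F1 E2 = 0" "F1 E3 = 0" "F1 E4 = 0"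
      "F2 E1 = 0" "F2 E2 = 1" "F2 E3 = 0" "F2 E4 = 0"
      "F3 E1 = 0" "F3 E2 = 0" "F3 E3 = 1" "F3 E4 = 0"
      "F4 E1 = 0" "F4 E2 = 0" "F4 E3 = 0" "F4 E4 = 1"
    and expand: "x = F1 x *\<^sub>R E1 + F2 x *\<^sub>R E2 + F3 x *\<^sub>R E3 + F4 x *\<^sub>R E4"
    and F_br: "F1 (br x y) = 2 * (F2 x * F3 y - F2 y * F3 x)"
      "F2 (br x y) = 2 * (F1 x * F3 y - F1 y * F3 x)"
      "F3 (br x y) = - 2 * (F1 x * F2 y - F1 y * F2 x)"
      "F4 (br x y) = 0"
begin

lemma coframe_eqI:
  assumes "F1 x = F1 y" "F2 x = F2 y" "F3 x = F3 y" "F4 x = F4 y"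
  shows "x = y"
  using expand[of x] expand[of y] assms by simp

lemma br_E4: "br x E4 = 0"
  by (rule coframe_eqI) (simp_all add: F_br F_E linear_0 linear_F)

lemma br_E: "br E1 E2 = (-2) *\<^sub>R E3" "br E1 E3 = 2 *\<^sub>R E2" "br E2 E3 = 2 *\<^sub>R E1"
  by (rule coframe_eqI; simp add: F_br F_E linear_neg linear_scale linear_F)+

lemma linear_expand:
  fixes g :: "'a \<Rightarrow> real"
  assumes "linear g"
  shows "g x = F1 x * g E1 + F2 x * g E2 + F3 x * g E3 + F4 x * g E4"
  by (subst expand[of x]) (simp add: linear_add[OF assms] linear_scale[OF assms])

lemma two_form_expand:
  assumes "two_form \<Omega>"
  shows "\<Omega> x y =
    \<Omega> E1 E2 * (F1 x * F2 y - F1 y * F2 x) + \<Omega> E1 E3 * (F1 x * F3 y - F1 y * F3 x) +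
    \<Omega> E1 E4 * (F1 x * F4 y - F1 y * F4 x) + \<Omega> E2 E3 * (F2 x * F3 y - F2 y * F3 x) +
    \<Omega> E2 E4 * (F2 x * F4 y - F2 y * F4 x) + \<Omega> E3 E4 * (F3 x * F4 y - F3 y * F4 x)"
proof -
  have lin: "linear (\<Omega> x)" "linear (\<lambda>x. \<Omega> x y)" for x y
    using assms by (auto simp: two_form_def bilinear_def)
  have self: "\<Omega> x x = 0" for x
    using assms by (simp add: two_form_def)
  have anti: "\<Omega> y x = - \<Omega> x y" for x y
  proof -
    have "\<Omega> (x + y) (x + y) = \<Omega> x x + \<Omega> x y + \<Omega> y x + \<Omega> y y"
      by (simp add: linear_add[OF lin(1)] linear_add[OF lin(2)])
    then show ?thesis
      unfolding self by linarith
  qed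
  show ?thesis
    using linear_expand[OF lin(2), of x y] linear_expand[OF lin(1), of E1 y]
      linear_expand[OF lin(1), of E2 y] linear_expand[OF lin(1), of E3 y]
      linear_expand[OF lin(1), of E4 y]
    by (simp add: self anti[of E2 E1] anti[of E3 E1] anti[of E4 E1] anti[of E3 E2]
        anti[of E4 E2] anti[of E4 E3] algebra_simps)
qed

text \<open>In dimension 4 the form \<open>wedge22 \<Omega> \<Omega>\<close> is the determinant of
  the coordinates of the four arguments times twice the Pfaffian of \<open>\<Omega>\<close>.\<close>

lemma wedge22_eq_0:
  assumes "two_form \<Omega>"
    and pfaffian: "\<Omega> E1 E2 * \<Omega> E3 E4 - \<Omega> E1 E3 * \<Omega> E2 E4 + \<Omega> E1 E4 * \<Omega> E2 E3 = 0"
  shows "wedge22 \<Omega> \<Omega> x y z w = 0"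
proof -
  \<comment> \<open>With the coefficients abbreviated, the expansion of \<open>\<Omega>\<close> is a
    terminating rewrite rule: its right-hand side no longer contains
    \<open>\<Omega>\<close>.\<close>
  define a b c d e f where "a = \<Omega> E1 E2" and "b = \<Omega> E1 E3" and "c = \<Omega> E1 E4"
    and "d = \<Omega> E2 E3" and "e = \<Omega> E2 E4" and "f = \<Omega> E3 E4"
  have pf: "a * f - b * e + c * d = 0"
    using pfaffian by (simp add: a_def b_def c_def d_def e_def f_def)
  have \<Omega>: "\<Omega> x y = a * (F1 x * F2 y - F1 y * F2 x) + b * (F1 x * F3 y - F1 y * F3 x) +
      c * (F1 x * F4 y - F1 y * F4 x) + d * (F2 x * F3 y - F2 y * F3 x) +
      e * (F2 x * F4 y - F2 y * F4 x) + f * (F3 x * F4 y - F3 y * F4 x)" for x y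
    unfolding a_def b_def c_def d_def e_def f_def by (rule two_form_expand[OF assms(1)])
  show ?thesis
    unfolding wedge22_def \<Omega> using pf by algebra
qed

lemma lie_automorphismI:
  assumes "linear \<phi>" "\<And>x. \<phi> (\<psi> x) = x" "\<And>x. \<psi> (\<phi> x) = x"
    and "\<And>x y. \<phi> (br x y) = br (\<phi> x) (\<phi> y)"
  shows "lie_automorphism br \<phi>"
  using assms o_bij[of \<psi> \<phi>] by (auto simp: lie_automorphism_def fun_eq_iff)

definition from_coords :: "real \<Rightarrow> real \<Rightarrow> real \<Rightarrow> real \<Rightarrow> 'a" where
  "from_coords a b c s = a *\<^sub>R E1 + b *\<^sub>R E2 + c *\<^sub>R E3 + s *\<^sub>R E4"

lemma F_from_coords:
  "F1 (from_coords a b c s) = a" "F2 (from_coords a b c s) = b"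
  "F3 (from_coords a b c s) = c" "F4 (from_coords a b c s) = s"
  by (simp_all add: from_coords_def linear_add linear_scale linear_F F_E)

section \<open>Explicit automorphisms from SO(1,2)\<close>

text \<open>The map is the pure Lorentz boost with first row \<open>(a, b, c)\<close>, a unit
  timelike covector. Rescaling \<open>E4\<close> by \<open>t\<close> is compatible with the bracket
  because \<open>E4\<close> is central and \<open>F4\<close> vanishes on brackets.\<close>

lemma timelike_automorphism:
  assumes hyp: "a\<^sup>2 - b\<^sup>2 - c\<^sup>2 = 1" and "a > 0" and "t \<noteq> 0"
  shows "\<exists>\<phi>. lie_automorphism br \<phi> \<and> (\<forall>x. F4 (\<phi> x) = t * F4 x) \<and>
    (\<forall>x. F1 (\<phi> x) = a * F1 x + b * F2 x + c * F3 x)"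
proof -
  define k where "k = 1 / (1 + a)"
  have k: "k * (1 + a) = 1"
    using \<open>a > 0\<close> by (simp add: k_def)
  have sq: "a * a - b * b - c * c = 1"
    using hyp by (simp add: power2_eq_square)
  define boost where "boost b c t x = from_coords (a * F1 x + b * F2 x + c * F3 x)
    (b * F1 x + (1 + k * b * b) * F2 x + k * b * c * F3 x)
    (c * F1 x + k * b * c * F2 x + (1 + k * c * c) * F3 x) (t * F4 x)" for b c t x
  have "linear (boost b c t)" for b c t
    by (rule linearI; rule coframe_eqI)
      (simp_all add: boost_def F_from_coords linear_add linear_scale linear_F algebra_simps)
  \<comment> \<open>The inverse boost has the opposite velocity. The claim is general in
    \<open>b c t\<close> because its instance at \<open>- b\<close>, \<open>- c\<close>,
    \<open>1 / t\<close> gives the composition in the other order.\<close>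
  moreover have inverse: "boost b c t (boost (- b) (- c) (1 / t) x) = x"
    if "a * a - b * b - c * c = 1" "t \<noteq> 0" for b c t x
    using that(2) by (intro coframe_eqI; simp add: boost_def F_from_coords)
      (use k that(1) in algebra)+
  then have "boost b c t (boost (- b) (- c) (1 / t) x) = x"
    "boost (- b) (- c) (1 / t) (boost b c t x) = x" for x
    using inverse[of b c t x] inverse[of "- b" "- c" "1 / t" x] sq \<open>t \<noteq> 0\<close> by simp_all
  moreover have "boost b c t (br x y) = br (boost b c t x) (boost b c t y)" for x y
    \<comment> \<open>The \<open>F4\<close> component is trivial; the other three are polynomial
      identities modulo \<open>k\<close> and \<open>sq\<close>.\<close>
    by (rule coframe_eqI; simp only: F_br F_from_coords boost_def; (simp; fail)?)
      (use k sq in algebra)+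
  ultimately have "lie_automorphism br (boost b c t)"
    by (intro lie_automorphismI)
  then show ?thesis
    by (intro exI[of _ "boost b c t"]) (simp add: boost_def F_from_coords)
qed

text \<open>The map first rotates the plane of \<open>E2\<close> and \<open>E3\<close> by the unit
  vector \<open>(b, c) / d\<close>, then boosts the plane of \<open>E1\<close> and \<open>E2\<close>
  with hyperbolic cosine \<open>d\<close> and hyperbolic sine \<open>a\<close>. No sign condition
  arises, as the unit spacelike covectors form a connected one-sheeted hyperboloid.\<close>

lemma spacelike_automorphism:
  assumes hyp: "b\<^sup>2 + c\<^sup>2 - a\<^sup>2 = 1" and "t \<noteq> 0"
  shows "\<exists>\<phi>. lie_automorphism br \<phi> \<and> (\<forall>x. F4 (\<phi> x) = t * F4 x) \<and>
    (\<forall>x. F2 (\<phi> x) = a * F1 x + b * F2 x + c * F3 x)"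
proof -
  define d k where "d = sqrt (1 + a\<^sup>2)" and "k = 1 / d"
  have "d > 0"
    by (simp add: d_def add_pos_nonneg)
  then have k: "k * d = 1"
    by (simp add: k_def)
  have sq: "d * d = 1 + a * a" "b * b + c * c = 1 + a * a"
    using hyp by (simp_all add: d_def power2_eq_square algebra_simps)
  define \<phi> where "\<phi> x = from_coords (d * F1 x + k * a * b * F2 x + k * a * c * F3 x)
    (a * F1 x + b * F2 x + c * F3 x) (k * b * F3 x - k * c * F2 x) (t * F4 x)" for x
  \<comment> \<open>The boost is undone first, then the rotation.\<close>
  define \<psi> where "\<psi> x = from_coords (d * F1 x - a * F2 x)
    (b * F2 x - k * a * b * F1 x - k * c * F3 x)
    (c * F2 x - k * a * c * F1 x + k * b * F3 x) (F4 x / t)" for x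
  have "linear \<phi>"
    by (rule linearI; rule coframe_eqI)
      (simp_all add: \<phi>_def F_from_coords linear_add linear_scale linear_F algebra_simps)
  moreover have "\<phi> (\<psi> x) = x" for x
    using \<open>t \<noteq> 0\<close> by (intro coframe_eqI; simp add: \<phi>_def \<psi>_def F_from_coords)
      (use k sq in algebra)+
  moreover have "\<psi> (\<phi> x) = x" for x
    using \<open>t \<noteq> 0\<close> by (intro coframe_eqI; simp add: \<phi>_def \<psi>_def F_from_coords)
      (use k sq in algebra)+
  moreover have "\<phi> (br x y) = br (\<phi> x) (\<phi> y)" for x y
    by (rule coframe_eqI; simp only: F_br F_from_coords \<phi>_def; (simp; fail)?)
      (use k sq in algebra)+
  ultimately have "lie_automorphism br \<phi>"
    by (intro lie_automorphismI)
  then show ?thesis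
    by (intro exI[of _ \<phi>]) (simp add: \<phi>_def F_from_coords)
qed

section \<open>Reduction to one covector, and the classification\<close>

text \<open>The pair is recovered from the scalar \<open>\<theta> E4\<close> and the covector
  \<open>\<Omega> z E4\<close>; the last conclusion expresses nondegeneracy through that
  covector.\<close>

lemma lcs_structure_normal_form:
  assumes lcs: "lcs_structure br (\<Omega>, \<theta>)"
  shows "\<theta> x = \<theta> E4 * F4 x" and "\<theta> E4 \<noteq> 0"
    and "\<Omega> x y = - \<Omega> (br x y) E4 / \<theta> E4 + wedge11 (\<lambda>z. \<Omega> z E4) F4 x y"
    and "(\<Omega> E1 E4)\<^sup>2 - (\<Omega> E2 E4)\<^sup>2 - (\<Omega> E3 E4)\<^sup>2 \<noteq> 0"
proof -
  have \<Omega>: "two_form \<Omega>" and lin_\<theta>: "linear \<theta>" and nondeg: "wedge22 \<Omega> \<Omega> \<noteq> (\<lambda>_ _ _ _. 0)"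
    and closed: "\<And>x y. \<theta> (br x y) = 0" and d\<Omega>: "\<And>x y z. ce_d2 br \<Omega> x y z = wedge12 \<theta> \<Omega> x y z"
    using lcs by (auto simp: lcs_structure_def ce_d1_def fun_eq_iff)
  have lin: "linear (\<Omega> x)" "linear (\<lambda>x. \<Omega> x y)" for x y
    using \<Omega> by (auto simp: two_form_def bilinear_def)
  \<comment> \<open>A closed 1-form kills all brackets, and \<open>E1\<close>, \<open>E2\<close>,
    \<open>E3\<close> are brackets up to a factor.\<close>
  have \<theta>_E: "\<theta> E1 = 0" "\<theta> E2 = 0" "\<theta> E3 = 0"
    using closed[of E2 E3] closed[of E1 E3] closed[of E1 E2]
    by (simp_all add: br_E linear_scale[OF lin_\<theta>] linear_neg[OF lin_\<theta>])
  show \<theta>: "\<theta> x = \<theta> E4 * F4 x" for x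
    using linear_expand[OF lin_\<theta>, of x] by (simp add: \<theta>_E)
  \<comment> \<open>This is the equation for the differential of \<open>\<Omega>\<close> at
    \<open>x\<close>, \<open>y\<close>, \<open>E4\<close>; centrality of \<open>E4\<close> leaves
    only one term of \<open>ce_d2\<close>.\<close>
  have contracted: "\<theta> E4 * \<Omega> x y = - \<Omega> (br x y) E4 + \<theta> E4 * wedge11 (\<lambda>z. \<Omega> z E4) F4 x y" for x y
    using d\<Omega>[of x y E4] \<theta>[of x] \<theta>[of y]
    by (simp add: ce_d2_def wedge12_def wedge11_def br_E4 linear_0[OF lin(2)] algebra_simps)
  have w: "\<theta> E4 * \<Omega> E1 E2 = 2 * \<Omega> E3 E4" "\<theta> E4 * \<Omega> E1 E3 = - 2 * \<Omega> E2 E4"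
    "\<theta> E4 * \<Omega> E2 E3 = - 2 * \<Omega> E1 E4"
    using contracted[of E1 E2] contracted[of E1 E3] contracted[of E2 E3]
    by (simp_all add: br_E wedge11_def F_E linear_scale[OF lin(2)] linear_neg[OF lin(2)])
  have pf: "\<Omega> E1 E2 * \<Omega> E3 E4 - \<Omega> E1 E3 * \<Omega> E2 E4 + \<Omega> E1 E4 * \<Omega> E2 E3 \<noteq> 0"
    using wedge22_eq_0[OF \<Omega>] nondeg by (metis ext)
  \<comment> \<open>If \<open>\<theta> E4\<close> were 0, then \<open>w\<close> would make
    \<open>\<Omega> E1 E4\<close>, \<open>\<Omega> E2 E4\<close> and \<open>\<Omega> E3 E4\<close>
    vanish, and the Pfaffian with them.\<close>
  show t: "\<theta> E4 \<noteq> 0"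
    using w pf by auto
  show "\<Omega> x y = - \<Omega> (br x y) E4 / \<theta> E4 + wedge11 (\<lambda>z. \<Omega> z E4) F4 x y"
    using contracted[of x y] t by (simp add: field_simps)
  have "\<theta> E4 * (\<Omega> E1 E2 * \<Omega> E3 E4 - \<Omega> E1 E3 * \<Omega> E2 E4 + \<Omega> E1 E4 * \<Omega> E2 E3) \<noteq> 0"
    using t pf by (rule no_zero_divisors)
  \<comment> \<open>Substituting \<open>w\<close> turns the Pfaffian into a multiple of the
    Lorentzian norm of the covector.\<close>
  moreover have "\<theta> E4 * (\<Omega> E1 E2 * \<Omega> E3 E4 - \<Omega> E1 E3 * \<Omega> E2 E4 + \<Omega> E1 E4 * \<Omega> E2 E3) =
      - 2 * ((\<Omega> E1 E4)\<^sup>2 - (\<Omega> E2 E4)\<^sup>2 - (\<Omega> E3 E4)\<^sup>2)"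
    using w by algebra
  ultimately show "(\<Omega> E1 E4)\<^sup>2 - (\<Omega> E2 E4)\<^sup>2 - (\<Omega> E3 E4)\<^sup>2 \<noteq> 0"
    by (intro notI) (simp only: mult_zero_right simp_thms)
qed

text \<open>The normal form says that \<open>\<Omega>\<close> is the twisted differential of
  \<open>\<Omega> z E4 / \<theta> E4\<close>, and the target is the twisted differential of
  \<open>\<beta>\<close> with respect to \<open>F4\<close>. Automorphisms commute with these
  operations, so matching the two pairs of 1-forms is enough.\<close>

lemma lcs_equivalent_twisted_exact:
  assumes lcs: "lcs_structure br (\<Omega>, \<theta>)" and \<phi>: "lie_automorphism br \<phi>"
    and F4: "\<And>x. F4 (\<phi> x) = \<theta> E4 * F4 x" and \<beta>: "\<And>x. \<beta> (\<phi> x) = \<Omega> x E4 / \<theta> E4"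
  shows "lcs_equivalent br (\<Omega>, \<theta>) (\<lambda>x y. ce_d1 br \<beta> x y + wedge11 \<beta> F4 x y, F4)"
proof (rule lcs_equivalent_pullbackI[OF lcs \<phi>])
  note nf = lcs_structure_normal_form[OF lcs]
  have br: "br (\<phi> x) (\<phi> y) = \<phi> (br x y)" for x y
    using \<phi> by (simp add: lie_automorphism_def)
  have "ce_d1 br \<beta> (\<phi> x) (\<phi> y) + wedge11 \<beta> F4 (\<phi> x) (\<phi> y) = \<Omega> x y" for x y
    by (subst nf(3)) (simp add: ce_d1_def br wedge11_def F4 \<beta> nf(2))
  moreover have "F4 (\<phi> x) = \<theta> x" for x
    using nf(1)[of x] by (simp add: F4)
  ultimately show "pullback_pair \<phi> (\<lambda>x y. ce_d1 br \<beta> x y + wedge11 \<beta> F4 x y, F4) = (\<Omega>, \<theta>)"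
    by (simp add: pullback_pair_def fun_eq_iff)
qed

lemma lcs_classification:
  assumes lcs: "lcs_structure br (\<Omega>, \<theta>)"
  shows "\<exists>r>0.
    lcs_equivalent br (\<Omega>, \<theta>) (\<lambda>x y. r * (wedge11 F1 F4 x y - 2 * wedge11 F2 F3 x y), F4) \<or>
    lcs_equivalent br (\<Omega>, \<theta>) (\<lambda>x y. - r * (wedge11 F1 F4 x y - 2 * wedge11 F2 F3 x y), F4) \<or>
    lcs_equivalent br (\<Omega>, \<theta>) (\<lambda>x y. r * (- 2 * wedge11 F1 F3 x y + wedge11 F2 F4 x y), F4)"
proof -
  note nf = lcs_structure_normal_form[OF lcs]
  have "two_form \<Omega>"
    using lcs by (simp add: lcs_structure_def)
  then have "linear (\<lambda>x. \<Omega> x E4)" and \<Omega>_E4: "\<Omega> E4 E4 = 0"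
    by (auto simp: two_form_def bilinear_def)
  define p q s where "p = \<Omega> E1 E4 / \<theta> E4" and "q = \<Omega> E2 E4 / \<theta> E4" and "s = \<Omega> E3 E4 / \<theta> E4"
  \<comment> \<open>There is no \<open>F4\<close> term because
    \<open>\<Omega> E4 E4 = 0\<close>.\<close>
  have \<alpha>: "\<Omega> x E4 / \<theta> E4 = p * F1 x + q * F2 x + s * F3 x" for x
    by (subst linear_expand[OF \<open>linear (\<lambda>x. \<Omega> x E4)\<close>])
      (simp add: \<Omega>_E4 p_def q_def s_def add_divide_distrib mult.commute)
  have "p\<^sup>2 - q\<^sup>2 - s\<^sup>2 = ((\<Omega> E1 E4)\<^sup>2 - (\<Omega> E2 E4)\<^sup>2 - (\<Omega> E3 E4)\<^sup>2) / (\<theta> E4)\<^sup>2"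
    by (simp add: p_def q_def s_def power_divide diff_divide_distrib)
  then have "p\<^sup>2 - q\<^sup>2 - s\<^sup>2 \<noteq> 0"
    using nf(2,4) by simp
  then consider (time) "p\<^sup>2 - q\<^sup>2 - s\<^sup>2 > 0" | (space) "q\<^sup>2 + s\<^sup>2 - p\<^sup>2 > 0"
    by linarith
  then show ?thesis
  proof cases
    case time
    define r where "r = sqrt (p\<^sup>2 - q\<^sup>2 - s\<^sup>2)"
    have r: "r > 0" "r\<^sup>2 = p\<^sup>2 - q\<^sup>2 - s\<^sup>2"
      using time by (simp_all add: r_def)
    have "p \<noteq> 0"
    proof
      assume "p = 0"
      then have "p\<^sup>2 = 0"
        by simp
      then show False
        using time zero_le_power2[of q] zero_le_power2[of s] by linarith
    qed
    \<comment> \<open>The boost needs a positive first coefficient, so the scaling takes the sign of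
      \<open>p\<close>. This is the origin of the two signs in the first family.\<close>
    define k where "k = sgn p * r"
    have k: "k \<noteq> 0" "k\<^sup>2 = r\<^sup>2" "p / k > 0"
      using \<open>p \<noteq> 0\<close> r(1) by (auto simp: k_def sgn_if power_mult_distrib divide_neg_neg zero_less_divide_iff)
    have "(p / k)\<^sup>2 - (q / k)\<^sup>2 - (s / k)\<^sup>2 = 1"
      using k(1) by (simp add: power_divide k(2) r(2) diff_divide_distrib[symmetric])
        (use time in simp)
    then obtain \<phi> where \<phi>: "lie_automorphism br \<phi>" "\<And>x. F4 (\<phi> x) = \<theta> E4 * F4 x"
      and F1: "\<And>x. F1 (\<phi> x) = p / k * F1 x + q / k * F2 x + s / k * F3 x"
      using timelike_automorphism[OF _ k(3) nf(2)] by blast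
    have "k * F1 (\<phi> x) = \<Omega> x E4 / \<theta> E4" for x
      using k(1) by (simp add: F1 \<alpha> field_simps)
    then have "lcs_equivalent br (\<Omega>, \<theta>)
        (\<lambda>x y. ce_d1 br (\<lambda>x. k * F1 x) x y + wedge11 (\<lambda>x. k * F1 x) F4 x y, F4)"
      by (rule lcs_equivalent_twisted_exact[OF lcs \<phi>])
    \<comment> \<open>By \<open>F_br\<close> the differential of \<open>F1\<close> is -2 times the
      wedge of \<open>F2\<close> and \<open>F3\<close>.\<close>
    also have "(\<lambda>x y. ce_d1 br (\<lambda>x. k * F1 x) x y + wedge11 (\<lambda>x. k * F1 x) F4 x y) =
        (\<lambda>x y. k * (wedge11 F1 F4 x y - 2 * wedge11 F2 F3 x y))"
      by (simp add: fun_eq_iff ce_d1_def wedge11_def F_br algebra_simps)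
    finally have equiv: "lcs_equivalent br (\<Omega>, \<theta>)
        (\<lambda>x y. k * (wedge11 F1 F4 x y - 2 * wedge11 F2 F3 x y), F4)" .
    have "k = r \<or> k = - r"
      using \<open>p \<noteq> 0\<close> by (auto simp: k_def sgn_if)
    with equiv r(1) show ?thesis
      by blast
  next
    case space
    define r where "r = sqrt (q\<^sup>2 + s\<^sup>2 - p\<^sup>2)"
    have r: "r > 0" "r\<^sup>2 = q\<^sup>2 + s\<^sup>2 - p\<^sup>2"
      using space by (simp_all add: r_def)
    have "(q / r)\<^sup>2 + (s / r)\<^sup>2 - (p / r)\<^sup>2 = 1"
      using space
      by (simp add: power_divide r(2) diff_divide_distrib[symmetric] add_divide_distrib[symmetric])
    then obtain \<phi> where \<phi>: "lie_automorphism br \<phi>" "\<And>x. F4 (\<phi> x) = \<theta> E4 * F4 x"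
      and F2: "\<And>x. F2 (\<phi> x) = p / r * F1 x + q / r * F2 x + s / r * F3 x"
      using spacelike_automorphism[OF _ nf(2)] by blast
    have "r * F2 (\<phi> x) = \<Omega> x E4 / \<theta> E4" for x
      using r(1) by (simp add: F2 \<alpha> field_simps)
    then have "lcs_equivalent br (\<Omega>, \<theta>)
        (\<lambda>x y. ce_d1 br (\<lambda>x. r * F2 x) x y + wedge11 (\<lambda>x. r * F2 x) F4 x y, F4)"
      by (rule lcs_equivalent_twisted_exact[OF lcs \<phi>])
    \<comment> \<open>Likewise the differential of \<open>F2\<close> is -2 times the wedge of
      \<open>F1\<close> and \<open>F3\<close>.\<close>
    also have "(\<lambda>x y. ce_d1 br (\<lambda>x. r * F2 x) x y + wedge11 (\<lambda>x. r * F2 x) F4 x y) =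
        (\<lambda>x y. r * (- 2 * wedge11 F1 F3 x y + wedge11 F2 F4 x y))"
      by (simp add: fun_eq_iff ce_d1_def wedge11_def F_br algebra_simps)
    finally show ?thesis
      using r(1) by blast
  qed
qed

end

section \<open>Specialisation to the concrete Lie algebra\<close>

theorem proposition3p6:
  fixes e1 e2 e3 :: sl2 and e4 :: real
    and f1 f2 f3 f4 :: "sl2 \<times> real \<Rightarrow> real"
    and \<Omega> :: "sl2 \<times> real \<Rightarrow> sl2 \<times> real \<Rightarrow> real"
    and \<theta> :: "sl2 \<times> real \<Rightarrow> real"
  assumes "is_basis [e1, e2, e3]"
    and "sl2_bracket e1 e2 = (-2) *\<^sub>R e3"
    and "sl2_bracket e1 e3 = 2 *\<^sub>R e2"
    and "sl2_bracket e2 e3 = 2 *\<^sub>R e1"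
    and "span {e4} = UNIV"
    and "is_dual_basis [(e1, 0), (e2, 0), (e3, 0), (0, e4)] [f1, f2, f3, f4]"
    and "lcs_structure sl2R_bracket (\<Omega>, \<theta>)"
  shows "\<exists>r>0.
    lcs_equivalent sl2R_bracket (\<Omega>, \<theta>)
      (\<lambda>x y. r * (wedge11 f1 f4 x y - 2 * wedge11 f2 f3 x y), f4) \<or>
    lcs_equivalent sl2R_bracket (\<Omega>, \<theta>)
      (\<lambda>x y. - r * (wedge11 f1 f4 x y - 2 * wedge11 f2 f3 x y), f4) \<or>
    lcs_equivalent sl2R_bracket (\<Omega>, \<theta>)
      (\<lambda>x y. r * (- 2 * wedge11 f1 f3 x y + wedge11 f2 f4 x y), f4)"
proof -
  have lin: "linear f1" "linear f2" "linear f3" "linear f4"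
    and val: "f1 (e1, 0) = 1" "f1 (e2, 0) = 0" "f1 (e3, 0) = 0" "f1 (0, e4) = 0"
      "f2 (e1, 0) = 0" "f2 (e2, 0) = 1" "f2 (e3, 0) = 0" "f2 (0, e4) = 0"
      "f3 (e1, 0) = 0" "f3 (e2, 0) = 0" "f3 (e3, 0) = 1" "f3 (0, e4) = 0"
      "f4 (e1, 0) = 0" "f4 (e2, 0) = 0" "f4 (e3, 0) = 0" "f4 (0, e4) = 1"
    using assms(6) by (simp_all add: is_dual_basis_def All_less_Suc numeral_eq_Suc)
  have expand: "x = f1 x *\<^sub>R (e1, 0) + f2 x *\<^sub>R (e2, 0) + f3 x *\<^sub>R (e3, 0) + f4 x *\<^sub>R (0, e4)" for x
  proof -
    obtain A t where x: "x = (A, t)" by (cases x)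
    have "A \<in> span {e1, e2, e3}"
      using assms(1) by (simp add: is_basis_def)
    then obtain a b c where "A - a *\<^sub>R e1 - b *\<^sub>R e2 - c *\<^sub>R e3 = 0"
      by (auto simp: span_insert)
    moreover have "t \<in> span {e4}"
      using assms(5) by simp
    then obtain s where "t = s * e4"
      by (auto simp: span_singleton)
    ultimately have "x = a *\<^sub>R (e1, 0) + b *\<^sub>R (e2, 0) + c *\<^sub>R (e3, 0) + s *\<^sub>R (0, e4)"
      by (simp add: x algebra_simps)
    moreover from this have "f1 x = a" "f2 x = b" "f3 x = c" "f4 x = s"
      using lin by (simp_all only: linear_add linear_scale val) simp_all
    ultimately show ?thesis
      by simp
  qed
  \<comment> \<open>Since \<open>ce_d1\<close> is minus evaluation on the bracket, the structure
    equations read backwards give the coordinates of a bracket required by the locale.\<close>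
  note d = ce_d1_dual_basis[OF assms(1-4,6), unfolded ce_d1_def wedge11_def]
  interpret sl2R_coframe sl2R_bracket "(e1, 0)" "(e2, 0)" "(e3, 0)" "(0, e4)" f1 f2 f3 f4
  proof (rule sl2R_coframe.intro)
    show "linear f1" "linear f2" "linear f3" "linear f4"
      by (fact lin)+
    fix x y
    show "x = f1 x *\<^sub>R (e1, 0) + f2 x *\<^sub>R (e2, 0) + f3 x *\<^sub>R (e3, 0) + f4 x *\<^sub>R (0, e4)"
      by (fact expand)
    show "f1 (sl2R_bracket x y) = 2 * (f2 x * f3 y - f2 y * f3 x)"
      "f2 (sl2R_bracket x y) = 2 * (f1 x * f3 y - f1 y * f3 x)"
      "f3 (sl2R_bracket x y) = - 2 * (f1 x * f2 y - f1 y * f2 x)"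
      "f4 (sl2R_bracket x y) = 0"
      using d[of x y] by simp_all
  qed (fact val)+
  show ?thesis
    by (rule lcs_classification[OF assms(7)])
qed

end
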